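(* Let $s$ and $p$ be positive integers. For $1\le n\le sp+1$, $$|\mathcal{A}^{(s)}_{p,n}| = \sum_{k=1}^{\left\lfloor \frac{sn+1}{sp+1}\right\rfloor}\binom{n-pk+k-2}{k-1}.$$ For $n\ge sp+2$, $$|\mathcal{A}^{(s)}_{p,n}| = \sum_{i=0}^{s}|\mathcal{A}^{(s)}_{p,n-1-ip}|.$$
   Context: $\mathbb{N}$ denotes the positive integers. For $(s,p,n)\in\mathbb{N}^3$, define $$\mathcal{A}^{(s)}_{p,n} := \{F\subset \{\underbrace{1,\ldots,1}_{s},\ldots,\underbrace{n-1,\ldots,n-1}_{s},n\} : n\in F \text{ and } \min F\ge p|F|\}.$$ Here $F$ ranges over sub-multisets of the multiset containing $s$ identical copies of each of $1,\ldots,n-1$ and exactly one copy of $n$; copies of the same integer are indistinguishable, so $F$ is determined by its multiplicities. $|F|$ is the number of elements of $F$ counted with multiplicity, and $\min F$ is its smallest element. $|\mathcal{A}^{(s)}_{p,n}|$ is the number of such multisets $F$. An empty sum equals $0$, and $\binom{m}{0}=1$ for every integer $m$ (including negative $m$). *)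

theory Defs
  imports Complex_Main "HOL-Library.Multiset"
begin

definition ground_mset :: "nat \<Rightarrow> nat \<Rightarrow> nat multiset" where
  "ground_mset s n = (\<Sum>j\<in>{1..<n}. replicate_mset s j) + {#n#}"

definition schreier_family :: "nat \<Rightarrow> nat \<Rightarrow> nat \<Rightarrow> nat multiset set" where
  "schreier_family s p n =
     {F. F \<subseteq># ground_mset s n \<and> n \<in># F \<and> Min (set_mset F) \<ge> p * size F}"

end

theory Submission
  imports Defs
begin

text \<open>
  Sort the multisets \<open>F\<close> of the family by their size \<open>Suc j\<close>.  Since \<open>n\<close> occurs exactly once and the
  lower bound for the minimum depends only on the size, removing \<open>n\<close> leaves an arbitrary multiset of
  size \<open>j\<close> over the \<open>n - p * Suc j\<close> integers in \<open>{p * Suc j..<n}\<close> with all multiplicities at most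
  \<open>s\<close>.  The number of these is the coefficient of \<open>x ^ j\<close> in \<open>(1 + x + \<dots> + x ^ s) ^ (n - p * Suc j)\<close>,
  so the cardinality of the family is a sum of such coefficients along a line of slope \<open>p\<close>
  (\<open>card_schreier_family\<close>).

  Both claims are properties of this sum.  For \<open>n \<le> s * p + 1\<close>, the only nonzero terms have
  \<open>j < s\<close>, where the bound \<open>s\<close> on the multiplicities cannot be violated, so the coefficients are the
  multiset coefficients (\<open>bounded_multichoose_eq_choose\<close>), and the range of nonzero terms is the range of
  summation in the claim.  The recurrence is the generalised Pascal rule, multiplication by one factor
  \<open>1 + x + \<dots> + x ^ s\<close>, applied to every term: the summand \<open>x ^ i\<close> shifts the line by
  \<open>Suc (i * p)\<close>.  The rule fails only for the zeroth power, but that term vanishes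
  for \<open>n \<ge> s * p + 2\<close>.
\<close>

section \<open>Multisets with bounded multiplicities\<close>

definition bounded_msets :: "nat \<Rightarrow> 'a set \<Rightarrow> nat \<Rightarrow> 'a multiset set" where
  "bounded_msets s A r = {G. set_mset G \<subseteq> A \<and> (\<forall>x. count G x \<le> s) \<and> size G = r}"

text \<open>The coefficient of \<open>x ^ r\<close> in \<open>(1 + x + \<dots> + x ^ s) ^ m\<close>, given by its generalised Pascal rule.\<close>

fun bounded_multichoose :: "nat \<Rightarrow> nat \<Rightarrow> nat \<Rightarrow> nat" where
  "bounded_multichoose s 0 r = (if r = 0 then 1 else 0)"
| "bounded_multichoose s (Suc m) r = (\<Sum>i\<le>min s r. bounded_multichoose s m (r - i))"

text \<open>A multiset over \<open>insert x A\<close> is determined by the multiplicity of \<open>x\<close> and the rest, which lies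
  over \<open>A\<close>.\<close>

lemma bounded_msets_insert:
  assumes "x \<notin> A"
  shows "bounded_msets s (insert x A) r =
    (\<Union>i\<le>min s r. (\<lambda>G. G + replicate_mset i x) ` bounded_msets s A (r - i))"
    (is "?L = ?R")
proof (intro equalityI subsetI)
  fix F assume F: "F \<in> ?L"
  define i where "i = count F x"
  define G where "G = filter_mset (\<lambda>y. y \<noteq> x) F"
  have split: "F = G + replicate_mset i x"
    unfolding G_def i_def by (rule multiset_eqI) auto
  have "size F = size G + i" by (subst split) simp
  then have "i \<le> min s r" "size G = r - i"
    using F by (auto simp: bounded_msets_def i_def)
  moreover have "set_mset G \<subseteq> A" "\<forall>y. count G y \<le> s"
    using F by (auto simp: bounded_msets_def G_def)
  ultimately have "i \<in> {..min s r}" "G \<in> bounded_msets s A (r - i)"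
    by (auto simp: bounded_msets_def)
  then show "F \<in> ?R" using split by blast
next
  fix F assume "F \<in> ?R"
  then obtain i G where i: "i \<le> min s r" and G: "G \<in> bounded_msets s A (r - i)"
    and F: "F = G + replicate_mset i x" by auto
  have "x \<notin># G" using G assms by (auto simp: bounded_msets_def)
  then have "count F y \<le> s" for y
    using G i F by (cases "y = x") (auto simp: bounded_msets_def not_in_iff)
  moreover have "set_mset F \<subseteq> insert x A"
    using G F by (auto simp: bounded_msets_def split: if_splits)
  ultimately show "F \<in> ?L"
    using G i F by (auto simp: bounded_msets_def)
qed

lemma bounded_msets_empty: "bounded_msets s {} r = (if r = 0 then {{#}} else {})"
  by (auto simp: bounded_msets_def)

lemma finite_bounded_msets:
  assumes "finite A"
  shows "finite (bounded_msets s A r)"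
  using assms by (induction A arbitrary: r rule: finite_induct)
    (auto simp: bounded_msets_empty bounded_msets_insert)

lemma card_bounded_msets:
  assumes "finite A"
  shows "card (bounded_msets s A r) = bounded_multichoose s (card A) r"
  using assms
proof (induction A arbitrary: r rule: finite_induct)
  case empty
  then show ?case by (simp add: bounded_msets_empty)
next
  case (insert x A)
  let ?f = "\<lambda>i G. G + replicate_mset i x"
  have count_x: "count (?f i G) x = i" if "G \<in> bounded_msets s A k" for i G k
    using that insert.hyps(2) by (auto simp: bounded_msets_def count_eq_zero_iff)
  have "card (bounded_msets s (insert x A) r) =
      (\<Sum>i\<le>min s r. card (?f i ` bounded_msets s A (r - i)))"
    unfolding bounded_msets_insert[OF insert.hyps(2)]
  proof (rule card_UN_disjoint)
    show "\<forall>i\<in>{..min s r}. finite (?f i ` bounded_msets s A (r - i))"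
      using insert.hyps(1) by (simp add: finite_bounded_msets)
    show "\<forall>i\<in>{..min s r}. \<forall>j\<in>{..min s r}. i \<noteq> j \<longrightarrow>
        ?f i ` bounded_msets s A (r - i) \<inter> ?f j ` bounded_msets s A (r - j) = {}"
      using count_x by (metis (no_types, lifting) disjoint_iff imageE)
  qed simp
  also have "\<dots> = (\<Sum>i\<le>min s r. bounded_multichoose s (card A) (r - i))"
    by (rule sum.cong) (auto simp: card_image inj_on_def insert.IH)
  finally show ?case using insert.hyps by simp
qed

lemma bounded_multichoose_eq_0:
  assumes "r > s * m"
  shows "bounded_multichoose s m r = 0"
  using assms by (induction m arbitrary: r) (auto simp: less_diff_conv)

text \<open>For \<open>r \<le> s\<close> the bound on the multiplicities is void, so these are the stars-and-bars numbers.\<close>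

lemma bounded_multichoose_eq_choose:
  assumes "r \<le> s"
  shows "bounded_multichoose s (Suc m) r = (m + r) choose r"
  using assms
proof (induction m arbitrary: r)
  case 0
  have "(\<Sum>i\<le>r. if r - i = 0 then 1 else 0) = (\<Sum>i\<le>r. if i = r then 1 else (0::nat))"
    by (rule sum.cong) auto
  then show ?case using 0 by (simp add: min_def)
next
  case (Suc m)
  have "bounded_multichoose s (Suc (Suc m)) r = (\<Sum>i\<le>r. (m + (r - i)) choose (r - i))"
    using Suc by (simp add: min_absorb2 del: bounded_multichoose.simps(2)
        add: bounded_multichoose.simps(2)[of s "Suc m"])
  also have "\<dots> = (\<Sum>i\<le>r. (m + i) choose i)"
    by (rule sum.nat_diff_reindex[of "\<lambda>i. (m + i) choose i" "Suc r", unfolded lessThan_Suc_atMost diff_Suc_Suc])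
  also have "\<dots> = (Suc m + r) choose r"
    using sum_choose_lower[of m r] by simp
  finally show ?case .
qed

section \<open>The family sorted by size\<close>

lemma less_div_iff_mult_Suc_le:
  fixes q :: nat
  assumes "q \<ge> 1"
  shows "j < n div q \<longleftrightarrow> q * Suc j \<le> n"
  using less_eq_div_iff_mult_less_eq[of q "Suc j" n] assms
  by (simp only: Suc_le_eq mult.commute[of q])

lemma count_ground_mset:
  "count (ground_mset s n) x = (if x = n then 1 else if 1 \<le> x \<and> x < n then s else 0)"
  by (auto simp: ground_mset_def count_sum)

text \<open>The hypothesis on \<open>p\<close> makes every element of \<open>F\<close> positive, so that each integer in \<open>{p * Suc j..<n}\<close>
  is available \<open>s\<close> times.\<close>

lemma schreier_family_eq:
  assumes "p \<ge> 1"
  shows "schreier_family s p n =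
    (\<Union>j<n div p. add_mset n ` bounded_msets s {p * Suc j..<n} j)"
    (is "?L = ?R")
proof (intro equalityI subsetI)
  fix F assume F: "F \<in> ?L"
  then have n: "n \<in># F" and sub: "F \<subseteq># ground_mset s n"
    and le_Min: "p * size F \<le> Min (set_mset F)"
    by (auto simp: schreier_family_def)
  have min: "p * size F \<le> x" if "x \<in># F" for x
    using le_Min Min_le[OF finite_set_mset that] by (rule order_trans)
  have count: "count F x \<le> (if x = n then 1 else if 1 \<le> x \<and> x < n then s else 0)" for x
    using mset_subset_eq_count[OF sub, of x] by (simp only: count_ground_mset)
  obtain G where G: "F = add_mset n G" using n by (metis multi_member_split)
  have "n \<notin># G" using count[of n] G by (simp add: not_in_iff)
  have "x \<in> {p * Suc (size G)..<n}" if "x \<in># G" for x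
  proof -
    have "x \<noteq> n" using that \<open>n \<notin># G\<close> by auto
    moreover have "count F x \<noteq> 0" using that G by simp
    ultimately have "x < n" using count[of x] by (metis le_zero_eq)
    then show ?thesis using min[of x] that G by simp
  qed
  moreover have "count G x \<le> s" for x
    using count[of x] G \<open>n \<notin># G\<close> by (cases "x = n") (auto simp: not_in_iff split: if_splits)
  moreover have "size G < n div p"
    unfolding less_div_iff_mult_Suc_le[OF assms] using min[OF n] by (simp only: G size_add_mset)
  ultimately have "size G \<in> {..<n div p}" "G \<in> bounded_msets s {p * Suc (size G)..<n} (size G)"
    by (auto simp: bounded_msets_def)
  then show "F \<in> ?R" using G by blast
next
  fix F assume "F \<in> ?R"
  then obtain j G where j: "j < n div p" and G: "G \<in> bounded_msets s {p * Suc j..<n} j"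
    and F: "F = add_mset n G" by auto
  have n: "p * Suc j \<le> n"
    using j unfolding less_div_iff_mult_Suc_le[OF assms] .
  have "n \<notin># G" using G by (auto simp: bounded_msets_def)
  have "count F x \<le> count (ground_mset s n) x" for x
  proof (cases "x \<in># G")
    case True
    then have "p * Suc j \<le> x" "x < n" using G by (auto simp: bounded_msets_def)
    moreover have "1 \<le> p * Suc j" using assms by simp
    ultimately have "1 \<le> x" "x < n" by linarith+
    then show ?thesis using G F by (auto simp: bounded_msets_def count_ground_mset)
  next
    case False
    then show ?thesis using F by (auto simp: not_in_iff count_ground_mset)
  qed
  then have "F \<subseteq># ground_mset s n" by (simp add: subseteq_mset_def)
  moreover have "p * size F \<le> Min (set_mset F)"
    using G F n by (auto simp: bounded_msets_def simp del: mult_Suc_right)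
  ultimately show "F \<in> ?L" using F by (simp add: schreier_family_def)
qed

lemma card_schreier_family:
  assumes "p \<ge> 1"
  shows "card (schreier_family s p n) =
    (\<Sum>j<n div p. bounded_multichoose s (n - p * Suc j) j)"
proof -
  have "card (schreier_family s p n) =
      (\<Sum>j<n div p. card (add_mset n ` bounded_msets s {p * Suc j..<n} j))"
    unfolding schreier_family_eq[OF assms]
  proof (rule card_UN_disjoint)
    show "\<forall>i\<in>{..<n div p}. \<forall>j\<in>{..<n div p}. i \<noteq> j \<longrightarrow>
        add_mset n ` bounded_msets s {p * Suc i..<n} i \<inter>
        add_mset n ` bounded_msets s {p * Suc j..<n} j = {}"
      by (auto simp: bounded_msets_def)
  qed (auto simp: finite_bounded_msets)
  also have "\<dots> = (\<Sum>j<n div p. bounded_multichoose s (n - p * Suc j) j)"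
  proof (rule sum.cong)
    fix j
    have "inj_on (add_mset n) (bounded_msets s {p * Suc j..<n} j)" by (simp add: inj_on_def)
    then show "card (add_mset n ` bounded_msets s {p * Suc j..<n} j) =
        bounded_multichoose s (n - p * Suc j) j"
      by (simp only: card_image card_bounded_msets finite_atLeastLessThan card_atLeastLessThan)
  qed simp
  finally show ?thesis .
qed

section \<open>The closed formula and the recurrence\<close>

text \<open>The term with index \<open>j = k - 1\<close> is nonzero exactly if \<open>j \<le> s * (n - p * Suc j)\<close>, that is, if
  \<open>k \<le> (s * n + 1) / (s * p + 1)\<close>.  For \<open>n \<le> s * p + 1\<close> this forces \<open>k \<le> s\<close>.\<close>

lemma card_schreier_family_small:
  assumes s: "s \<ge> 1" and p: "p \<ge> 1" and n: "n \<le> s * p + 1"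
  shows "real (card (schreier_family s p n)) =
    (\<Sum>k = 1..nat \<lfloor>real (s * n + 1) / real (s * p + 1)\<rfloor>.
       (real n - real p * real k + real k - 2) gchoose (k - 1))"
proof -
  define K where "K = (s * n + 1) div (s * p + 1)"
  have floor: "nat \<lfloor>real (s * n + 1) / real (s * p + 1)\<rfloor> = K"
    unfolding K_def by (simp add: floor_divide_of_nat_eq del: of_nat_add of_nat_mult of_nat_Suc)
  have K_iff: "j < K \<longleftrightarrow> (s * p + 1) * Suc j \<le> s * n + 1" for j
    unfolding K_def by (rule less_div_iff_mult_Suc_le) simp
  note div_iff = less_div_iff_mult_Suc_le[OF p]
  have le_n: "p * Suc j \<le> n" and in_range: "j \<le> s * (n - p * Suc j)" if "j < K" for j
  proof -
    have *: "s * (p * Suc j) + j \<le> s * n" using that[unfolded K_iff] by (simp add: algebra_simps)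
    then have "s * (p * Suc j) \<le> s * n" by linarith
    then show "p * Suc j \<le> n" using s by (simp del: mult_Suc_right)
    show "j \<le> s * (n - p * Suc j)" using * by (simp add: diff_mult_distrib2 del: mult_Suc_right)
  qed
  have vanish: "bounded_multichoose s (n - p * Suc j) j = 0" if "j < n div p" "\<not> j < K" for j
  proof (rule bounded_multichoose_eq_0)
    have "s * n < s * (p * Suc j) + j" using that(2)[unfolded K_iff] by (simp add: algebra_simps)
    moreover have "s * (p * Suc j) \<le> s * n"
      using that(1)[unfolded div_iff] by (rule mult_le_mono2)
    ultimately show "s * (n - p * Suc j) < j"
      unfolding diff_mult_distrib2 by linarith
  qed
  have term_eq: "real (bounded_multichoose s (n - p * Suc j) j) =
      (real n - real p * real (Suc j) + real (Suc j) - 2) gchoose j" if "j < K" for j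
  proof (cases "n - p * Suc j")
    case 0
    then have "j = 0" using in_range[OF that] by simp
    then show ?thesis using 0 by simp
  next
    case (Suc m)
    have n_eq: "n = p * Suc j + Suc m" using Suc by simp
    have "Suc j \<le> s"
    proof (rule ccontr)
      assume "\<not> Suc j \<le> s"
      then have "(s * p + 1) * Suc s \<le> (s * p + 1) * Suc j" by (intro mult_le_mono2) simp
      also have "\<dots> \<le> s * n + 1" using that[unfolded K_iff] .
      also have "\<dots> \<le> s * (s * p + 1) + 1" using n by (simp add: mult_le_mono2 del: mult_Suc_right)
      finally have "s * p = 0" by (simp add: algebra_simps)
      then show False using s p by simp
    qed
    then have "bounded_multichoose s (n - p * Suc j) j = (m + j) choose j"
      using Suc bounded_multichoose_eq_choose[of j s m] by simp
    moreover have "real n - real p * real (Suc j) + real (Suc j) - 2 = real (m + j)"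
      unfolding n_eq by (simp add: algebra_simps)
    ultimately show ?thesis by (simp only: binomial_gbinomial)
  qed
  have "card (schreier_family s p n) = (\<Sum>j<K. bounded_multichoose s (n - p * Suc j) j)"
    unfolding card_schreier_family[OF p]
  proof (rule sum.mono_neutral_right)
    show "{..<K} \<subseteq> {..<n div p}" 
      by (intro subsetI) (simp only: lessThan_iff div_iff le_n)
    show "\<forall>j\<in>{..<n div p} - {..<K}. bounded_multichoose s (n - p * Suc j) j = 0"
      using vanish by auto
  qed simp
  then have "real (card (schreier_family s p n)) =
      (\<Sum>j<K. (real n - real p * real (Suc j) + real (Suc j) - 2) gchoose j)"
    using term_eq by simp
  also have "\<dots> = (\<Sum>k = 1..K. (real n - real p * real k + real k - 2) gchoose (k - 1))"
    by (rule sum.reindex_bij_witness[where i = "\<lambda>k. k - 1" and j = Suc]) auto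
  finally show ?thesis unfolding floor .
qed

lemma card_schreier_family_rec:
  assumes p: "p \<ge> 1" and n: "n \<ge> s * p + 2" and s: "s \<ge> 1"
  shows "card (schreier_family s p n) = (\<Sum>i = 0..s. card (schreier_family s p (n - 1 - i * p)))"
proof -
  let ?w = "bounded_multichoose s"
  define N where "N = (n - 1) div p"
  have N_iff: "j < N \<longleftrightarrow> p * Suc j \<le> n - 1" for j
    unfolding N_def by (rule less_div_iff_mult_Suc_le[OF p])
  \<comment> \<open>Shifting the index by \<open>i\<close> makes the first argument of the coefficients independent of \<open>i\<close>, so
    that the sum over \<open>i\<close> becomes an instance of the Pascal rule.\<close>
  have shifted: "card (schreier_family s p (n - 1 - i * p)) =
      (\<Sum>j = i..<N. ?w (n - 1 - p * Suc j) (j - i))" if "i \<le> s" for i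
  proof -
    have "(n - 1 - i * p) div p = N - i"
    proof -
      have "i * p \<le> s * p" using that by simp
      then have "n - 1 = (n - 1 - i * p) + i * p" using n by linarith
      then have "N = ((n - 1 - i * p) + i * p) div p" unfolding N_def by (rule arg_cong)
      also have "\<dots> = i + (n - 1 - i * p) div p" using p by (intro div_mult_self1) simp
      finally show ?thesis by simp
    qed
    then have "card (schreier_family s p (n - 1 - i * p)) =
        (\<Sum>j<N - i. ?w (n - 1 - i * p - p * Suc j) j)"
      using card_schreier_family[OF p] by simp
    also have "\<dots> = (\<Sum>j = i..<N. ?w (n - 1 - p * Suc j) (j - i))"
      by (rule sum.reindex_bij_witness[where i = "\<lambda>j. j - i" and j = "\<lambda>j. j + i"])
        (auto simp: algebra_simps)
    finally show ?thesis .
  qed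
  have "(\<Sum>i = 0..s. card (schreier_family s p (n - 1 - i * p))) =
      (\<Sum>i = 0..s. \<Sum>j\<in>{..<N}. if i \<le> j then ?w (n - 1 - p * Suc j) (j - i) else 0)"
  proof (rule sum.cong)
    fix i assume "i \<in> {0..s}"
    moreover have "{..<N} \<inter> {j. i \<le> j} = {i..<N}" by auto
    ultimately show "card (schreier_family s p (n - 1 - i * p)) =
        (\<Sum>j<N. if i \<le> j then ?w (n - 1 - p * Suc j) (j - i) else 0)"
      by (simp only: shifted sum.If_cases finite_lessThan atLeastAtMost_iff sum.neutral_const add_0_right)
  qed simp
  also have "\<dots> = (\<Sum>j<N. \<Sum>i = 0..s. if i \<le> j then ?w (n - 1 - p * Suc j) (j - i) else 0)"
    by (rule sum.swap)
  also have "\<dots> = (\<Sum>j<N. ?w (n - p * Suc j) j)"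
  proof (rule sum.cong)
    fix j assume "j \<in> {..<N}"
    then have "p * Suc j \<le> n - 1" using N_iff by simp
    then have "n - p * Suc j = Suc (n - 1 - p * Suc j)" using n by linarith
    moreover have "{0..s} \<inter> {i. i \<le> j} = {..min s j}" by auto
    ultimately show "(\<Sum>i = 0..s. if i \<le> j then ?w (n - 1 - p * Suc j) (j - i) else 0) =
        ?w (n - p * Suc j) j"
      by (simp add: sum.If_cases del: mult_Suc_right)
  qed simp
  also have "\<dots> = (\<Sum>j<n div p. ?w (n - p * Suc j) j)"
  proof (rule sum.mono_neutral_left)
    show "{..<N} \<subseteq> {..<n div p}" unfolding N_def by (simp add: div_le_mono)
    \<comment> \<open>The two ranges differ at most by \<open>p * Suc j = n\<close>.  There \<open>j > 0\<close>, because \<open>n > p\<close>, so the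
      coefficient of \<open>x ^ j\<close> in the zeroth power vanishes.\<close>
    show "\<forall>j\<in>{..<n div p} - {..<N}. ?w (n - p * Suc j) j = 0"
    proof
      fix j assume "j \<in> {..<n div p} - {..<N}"
      then have "\<not> p * Suc j \<le> n - 1" unfolding N_iff[symmetric] by simp
      then have 0: "n - p * Suc j = 0" by linarith
      have "p \<le> s * p" using s by simp
      then have "p < n" using n by linarith
      then have "j \<noteq> 0" using 0 by (cases j) auto
      then show "?w (n - p * Suc j) j = 0" by (simp add: 0 del: mult_Suc_right)
    qed
  qed simp
  finally show ?thesis using card_schreier_family[OF p] by simp
qed

theorem theorem1p2:
  fixes s p :: nat
  assumes "s \<ge> 1" and "p \<ge> 1"
  shows "(\<forall>n::nat. 1 \<le> n \<and> n \<le> s * p + 1 \<longrightarrow>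
            real (card (schreier_family s p n)) =
              (\<Sum>k = 1..nat \<lfloor>real (s * n + 1) / real (s * p + 1)\<rfloor>.
                 (real n - real p * real k + real k - 2) gchoose (k - 1)))
       \<and> (\<forall>n::nat. n \<ge> s * p + 2 \<longrightarrow>
            card (schreier_family s p n) =
              (\<Sum>i = 0..s. card (schreier_family s p (n - 1 - i * p))))"
  using card_schreier_family_small[OF assms] card_schreier_family_rec[OF assms(2) _ assms(1)]
  by blast

end
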